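(* Let $L\subset\mathbb{R}^2$ be an equilateral triangular lattice whose unit triangle has side length $a>0$, let $P\in L$, and let $u\in\mathbb{R}^2$ be a unit vector whose direction makes an angle of $15^\circ$ with a side of a unit triangle of $L$. For $\gamma>0$ let $S_{\gamma}$ be the scaling along $u$ with factor $\gamma$ and drag center $P$. Then for every integer $k\ge 1$ the image $S_{\gamma}(L)$ with $\gamma=(7-4\sqrt{3})^k$ is again an equilateral triangular lattice. Moreover, for $k=1$, i.e. $\gamma=7-4\sqrt3$, the side length of the unit triangle of the resulting lattice is $(2-\sqrt{3})\,a$.
   Context: An equilateral triangular lattice with side length $a$ is a set of the form $\{Q+m v+n w : m,n\in\mathbb{Z}\}\subset\mathbb{R}^2$, where $Q\in\mathbb{R}^2$ and $v,w$ are vectors of length $a$ with an angle of $60^\circ$ between them; its unit triangles are the equilateral triangles of side $a$ with vertices in the lattice, so their sides are parallel to $v$, $w$ or $v-w$. An angle between a direction and a side means the (acute, unoriented) angle between the corresponding lines. The (directional) scaling along a unit vector $u$ with factor $\gamma>0$ and drag center $P$ is the affine map $S_\gamma(x)=x+(\gamma-1)\langle x-P,u\rangle u$, which multiplies the component of $x-P$ along $u$ by $\gamma$ and leaves the component orthogonal to $u$ unchanged. *)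

theory Defs
  imports "HOL-Analysis.Analysis"
begin

definition vec_angle :: "real^2 \<Rightarrow> real^2 \<Rightarrow> real" where
  "vec_angle x y = arccos ((x \<bullet> y) / (norm x * norm y))"

(* For nonzero x and y this is the angle in [0, pi/2] between the lines they span. *)
definition line_angle :: "real^2 \<Rightarrow> real^2 \<Rightarrow> real" where
  "line_angle x y = arccos (\<bar>x \<bullet> y\<bar> / (norm x * norm y))"

definition equilateral_lattice :: "real \<Rightarrow> (real^2) set \<Rightarrow> bool" where
  "equilateral_lattice a L \<longleftrightarrow> a > 0 \<and>
     (\<exists>Q v w. norm v = a \<and> norm w = a \<and> vec_angle v w = pi / 3 \<and>
        L = {Q + of_int m *\<^sub>R v + of_int n *\<^sub>R w | (m::int) (n::int). True})"

definition unit_triangle :: "real \<Rightarrow> (real^2) set \<Rightarrow> real^2 \<Rightarrow> real^2 \<Rightarrow> real^2 \<Rightarrow> bool" where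
  "unit_triangle a L A B C \<longleftrightarrow>
     A \<in> L \<and> B \<in> L \<and> C \<in> L \<and> dist A B = a \<and> dist B C = a \<and> dist C A = a"

definition scaling :: "real^2 \<Rightarrow> real^2 \<Rightarrow> real \<Rightarrow> real^2 \<Rightarrow> real^2" where
  "scaling P u \<gamma> x = x + ((\<gamma> - 1) * ((x - P) \<bullet> u)) *\<^sub>R u"

end

(* Put t = 2 - sqrt 3 = tan 15 deg, so that t^2 = 4 t - 1 and 7 - 4 sqrt 3 = t^2.  The lattice has
   a 60 degree basis p, q with p at 15 degrees to u and q at 15 degrees to the normal of u.
   The linear part of the scaling by t^2 then sends p to t q and q to t (4 q - p).  As (q, 4 q - p)
   is another basis of the lattice, the scaling acts on L as the homothety with centre P and
   ratio t; iterating k times gives ratio t^k. *)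
theory Submission
  imports Defs
begin

section \<open>Triangular lattices, their bases and angle conditions\<close>

definition lattice_at :: "real^2 \<Rightarrow> real^2 \<Rightarrow> real^2 \<Rightarrow> (real^2) set" where
  "lattice_at P v w = {P + of_int m *\<^sub>R v + of_int n *\<^sub>R w | (m::int) (n::int). True}"

text \<open>Applied once in each direction, this shows that two bases related by an invertible
  integer matrix generate the same lattice.\<close>

lemma lattice_at_subset:
  fixes i j k l :: int
  assumes "v' = of_int i *\<^sub>R v + of_int j *\<^sub>R w" "w' = of_int k *\<^sub>R v + of_int l *\<^sub>R w"
  shows "lattice_at P v' w' \<subseteq> lattice_at P v w"
proof
  fix z assume "z \<in> lattice_at P v' w'"
  then obtain m n :: int where "z = P + of_int m *\<^sub>R v' + of_int n *\<^sub>R w'"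
    by (auto simp: lattice_at_def)
  then have "z = P + of_int (m * i + n * k) *\<^sub>R v + of_int (m * j + n * l) *\<^sub>R w"
    by (simp add: assms algebra_simps)
  then show "z \<in> lattice_at P v w"
    unfolding lattice_at_def by blast
qed

lemma lattice_at_translate:
  assumes "P \<in> lattice_at Q v w"
  shows "lattice_at Q v w = lattice_at P v w"
proof -
  obtain i j :: int where P: "P = Q + of_int i *\<^sub>R v + of_int j *\<^sub>R w"
    using assms by (auto simp: lattice_at_def)
  have "Q + of_int m *\<^sub>R v + of_int n *\<^sub>R w = P + of_int (m - i) *\<^sub>R v + of_int (n - j) *\<^sub>R w"
    and "P + of_int m *\<^sub>R v + of_int n *\<^sub>R w = Q + of_int (m + i) *\<^sub>R v + of_int (n + j) *\<^sub>R w"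
    for m n :: int
    by (simp_all add: P algebra_simps)
  then show ?thesis
    unfolding lattice_at_def by blast
qed

lemma vec_angle_eq_pi_third_iff:
  assumes "norm v = a" "norm w = a" "a > 0"
  shows "vec_angle v w = pi / 3 \<longleftrightarrow> v \<bullet> w = a\<^sup>2 / 2"
proof -
  define r where "r = (v \<bullet> w) / (a * a)"
  have b: "\<bar>r\<bar> \<le> 1"
    using Cauchy_Schwarz_ineq2[of v w] assms by (simp add: r_def abs_mult)
  have angle: "vec_angle v w = arccos r"
    by (simp only: vec_angle_def r_def assms)
  have "vec_angle v w = pi / 3 \<longleftrightarrow> r = 1 / 2"
  proof
    assume "vec_angle v w = pi / 3"
    then show "r = 1 / 2"
      using angle cos_arccos_abs[OF b] cos_60 by metis
  next
    assume "r = 1 / 2"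
    then have "vec_angle v w = arccos (cos (pi / 3))"
      by (simp only: angle cos_60)
    also have "\<dots> = pi / 3"
      by (rule arccos_cos) simp_all
    finally show "vec_angle v w = pi / 3" .
  qed
  also have "\<dots> \<longleftrightarrow> v \<bullet> w = a\<^sup>2 / 2"
    using assms(3) by (auto simp: r_def field_simps power2_eq_square)
  finally show ?thesis .
qed

text \<open>Trading \<open>arccos\<close> for an inner product turns everything that follows into
  polynomial algebra.\<close>

lemma equilateral_lattice_iff:
  "equilateral_lattice a L \<longleftrightarrow>
     a > 0 \<and> (\<exists>Q v w. norm v = a \<and> norm w = a \<and> v \<bullet> w = a\<^sup>2 / 2 \<and> L = lattice_at Q v w)"
proof (cases "a > 0")
  case True
  have "norm v = a \<and> norm w = a \<and> vec_angle v w = pi / 3 \<and> R \<longleftrightarrow>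
      norm v = a \<and> norm w = a \<and> v \<bullet> w = a\<^sup>2 / 2 \<and> R" for v w and R
    using vec_angle_eq_pi_third_iff[OF _ _ True] by blast
  then show ?thesis
    by (simp only: equilateral_lattice_def lattice_at_def)
qed (simp add: equilateral_lattice_def)

text \<open>Three vectors in the plane are linearly dependent, so their Gram determinant vanishes;
  this is its expansion.\<close>

lemma gram_determinant_zero:
  fixes x y z :: "real^2"
  shows "(x \<bullet> x) * (y \<bullet> y) * (z \<bullet> z) + 2 * (x \<bullet> y) * (y \<bullet> z) * (x \<bullet> z) =
    (x \<bullet> x) * (y \<bullet> z)\<^sup>2 + (y \<bullet> y) * (x \<bullet> z)\<^sup>2 + (z \<bullet> z) * (x \<bullet> y)\<^sup>2"
  by (simp add: inner_vec_def sum_2) algebra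

lemma cos_pi_twelfth_squared: "(cos (pi / 12))\<^sup>2 = (2 + sqrt 3) / 4"
  using cos_double_cos[of "pi / 12"] cos_30 by simp

text \<open>Squaring removes the sign left open by an unoriented angle. Since 2 + sqrt 3 is the
  inverse of 2 - sqrt 3, the squared cosine of 15 degrees is 1 / (4 t) with t = 2 - sqrt 3.\<close>

lemma line_angle_pi_twelfthD:
  assumes "norm u = 1" "norm e = a" "a > 0" "line_angle u e = pi / 12"
  shows "4 * (2 - sqrt 3) * (u \<bullet> e)\<^sup>2 = a\<^sup>2"
proof -
  have "\<bar>u \<bullet> e\<bar> / a \<le> 1"
    using Cauchy_Schwarz_ineq2[of u e] assms by simp
  then have "\<bar>u \<bullet> e\<bar> / a = cos (line_angle u e)"
    using assms(1-3) by (simp add: line_angle_def cos_arccos_abs)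
  then have "\<bar>u \<bullet> e\<bar> = cos (pi / 12) * a"
    unfolding assms(4) using \<open>a > 0\<close> by (simp add: field_simps)
  then have "(u \<bullet> e)\<^sup>2 = (2 + sqrt 3) / 4 * a\<^sup>2"
    by (metis power2_abs power_mult_distrib cos_pi_twelfth_squared)
  then have "4 * (2 - sqrt 3) * (u \<bullet> e)\<^sup>2 = (2 - sqrt 3) * (2 + sqrt 3) * a\<^sup>2"
    by (simp only: mult_ac)
  also have "(2 - sqrt 3) * (2 + sqrt 3) = (1::real)"
    by (simp add: algebra_simps)
  finally show ?thesis
    by simp
qed

text \<open>Allows an arbitrary side of a unit triangle to replace the first basis vector. The
  length condition on \<open>e\<close> forces m^2 + m n + n^2 = 1, which is also the determinant of
  the change of basis.\<close>

lemma unit_vector_extends_to_basis: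
  assumes v: "norm v = a" and w: "norm w = a" and vw: "v \<bullet> w = a\<^sup>2 / 2" and "a > 0"
    and e: "norm e = a" "e = of_int m *\<^sub>R v + of_int n *\<^sub>R w"
  obtains f where "norm f = a" "e \<bullet> f = a\<^sup>2 / 2" "lattice_at P v w = lattice_at P e f"
proof -
  \<comment> \<open>the rotation by 60 degrees taking v to w takes w to w - v, and e to f\<close>
  define f where "f = of_int (- n) *\<^sub>R v + of_int (m + n) *\<^sub>R w"
  have sq: "v \<bullet> v = a\<^sup>2" "w \<bullet> w = a\<^sup>2" "w \<bullet> v = a\<^sup>2 / 2"
    using v w vw by (simp_all add: dot_square_norm inner_commute)
  have "e \<bullet> e = a\<^sup>2"
    using e by (simp add: dot_square_norm)
  then have "a\<^sup>2 * (of_int m * of_int m + of_int m * of_int n + of_int n * of_int n) = a\<^sup>2 * 1"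
    unfolding e(2) by (simp add: sq vw inner_add_left inner_add_right algebra_simps)
  then have mnr: "of_int m * of_int m + of_int m * of_int n + of_int n * of_int n = (1::real)"
    using \<open>a > 0\<close> by (subst (asm) mult_cancel_left) simp
  then have "of_int (m * m + m * n + n * n) = (of_int 1 :: real)"
    by simp
  then have mn: "m * m + m * n + n * n = 1"
    by (simp only: of_int_eq_iff)
  have "f \<bullet> f = a\<^sup>2 * (of_int m * of_int m + of_int m * of_int n + of_int n * of_int n)"
    unfolding f_def by (simp add: sq vw inner_add_left inner_add_right inner_diff_left inner_diff_right algebra_simps)
  then have "norm f = a"
    using mnr \<open>a > 0\<close> by (simp add: norm_eq_sqrt_inner)
  moreover have "e \<bullet> f = a\<^sup>2 / 2 * (of_int m * of_int m + of_int m * of_int n + of_int n * of_int n)"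
    unfolding f_def e(2)
    by (simp add: sq vw inner_add_left inner_add_right inner_diff_left inner_diff_right) (simp add: field_simps)
  then have "e \<bullet> f = a\<^sup>2 / 2"
    using mnr by simp
  moreover have "lattice_at P v w = lattice_at P e f"
  proof
    \<comment> \<open>The coefficients come from the adjugate of the matrix taking \<open>v\<close>,
      \<open>w\<close> to \<open>e\<close>, \<open>f\<close>; as its determinant is 1, they give the
      inverse.\<close>
    have "of_int (m + n) *\<^sub>R e + of_int (- n) *\<^sub>R f = of_int (m * m + m * n + n * n) *\<^sub>R v"
      and "of_int n *\<^sub>R e + of_int m *\<^sub>R f = of_int (m * m + m * n + n * n) *\<^sub>R w"
      unfolding f_def e(2) by (simp_all add: algebra_simps)
    then show "lattice_at P v w \<subseteq> lattice_at P e f"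
      using mn by (intro lattice_at_subset[where i = "m + n" and j = "- n" and k = n and l = m]) auto
    show "lattice_at P e f \<subseteq> lattice_at P v w"
      using e(2) f_def by (rule lattice_at_subset)
  qed
  ultimately show ?thesis
    by (rule that)
qed

section \<open>Scalings and their action on lattices\<close>

lemma scaling_lattice_at:
  "scaling P u \<gamma> ` lattice_at P v w =
     lattice_at P (v + ((\<gamma> - 1) * (v \<bullet> u)) *\<^sub>R u) (w + ((\<gamma> - 1) * (w \<bullet> u)) *\<^sub>R u)"
proof -
  have "scaling P u \<gamma> (P + of_int m *\<^sub>R v + of_int n *\<^sub>R w) =
      P + of_int m *\<^sub>R (v + ((\<gamma> - 1) * (v \<bullet> u)) *\<^sub>R u)
        + of_int n *\<^sub>R (w + ((\<gamma> - 1) * (w \<bullet> u)) *\<^sub>R u)" for m n :: int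
    by (simp add: scaling_def inner_add_left algebra_simps)
  then show ?thesis
    unfolding lattice_at_def by (force simp: image_iff)
qed

lemma scaling_mult:
  assumes "norm u = 1"
  shows "scaling P u (\<gamma> * \<delta>) x = scaling P u \<gamma> (scaling P u \<delta> x)"
proof -
  have "u \<bullet> u = 1"
    using assms by (simp add: dot_square_norm)
  then show ?thesis
    by (simp add: scaling_def inner_add_left inner_diff_left algebra_simps)
qed

text \<open>With \<open>p\<close> at 15 and \<open>q\<close> at 75 degrees to the line of
  \<open>u\<close>, the components of \<open>p\<close> and \<open>t *\<^sub>R q\<close> normal to
  \<open>u\<close> cancel, because t = tan 15 deg. Showing that the difference \<open>d\<close> of
  the two sides has length zero avoids choosing a normal vector.\<close>

lemma fifteen_degree_relation:
  assumes u: "norm u = 1" and p: "norm p = a" and q: "norm q = a" and pq: "p \<bullet> q = a\<^sup>2 / 2"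
    and t: "t\<^sup>2 = 4 * t - 1"
    and pu: "4 * t * (p \<bullet> u)\<^sup>2 = a\<^sup>2" and qu: "q \<bullet> u = t * (p \<bullet> u)"
  shows "p - t *\<^sub>R q = ((1 - t\<^sup>2) * (p \<bullet> u)) *\<^sub>R u"
proof -
  define d where "d = p - t *\<^sub>R q - ((1 - t\<^sup>2) * (p \<bullet> u)) *\<^sub>R u"
  have sq: "p \<bullet> p = a\<^sup>2" "q \<bullet> q = a\<^sup>2" "u \<bullet> u = 1"
    using u p q by (simp_all add: dot_square_norm)
  have "d \<bullet> d = a\<^sup>2 - t * a\<^sup>2 + t\<^sup>2 * a\<^sup>2 - (1 - t\<^sup>2)\<^sup>2 * (p \<bullet> u)\<^sup>2"
    unfolding d_def
    by (simp add: inner_diff_left inner_diff_right inner_commute[of u p] inner_commute[of u q] inner_commute[of q p] sq pq qu)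
      (simp add: algebra_simps power2_eq_square)
  also have "\<dots> = 0"
    using t pu by algebra
  finally show ?thesis
    by (simp add: d_def)
qed

text \<open>The factor \<open>r\<close> makes the step repeatable: the output has the shape of the
  input, with \<open>t * r\<close> for \<open>r\<close>.\<close>

lemma scaling_homothetic:
  assumes u: "norm u = 1" and t: "t\<^sup>2 = 4 * t - 1"
    and rel: "p - t *\<^sub>R q = ((1 - t\<^sup>2) * (p \<bullet> u)) *\<^sub>R u" and qu: "q \<bullet> u = t * (p \<bullet> u)"
  shows "scaling P u (t\<^sup>2) ` lattice_at P (r *\<^sub>R p) (r *\<^sub>R q) =
    lattice_at P ((t * r) *\<^sub>R p) ((t * r) *\<^sub>R q)"
proof -
  have neg: "((t\<^sup>2 - 1) * (p \<bullet> u)) *\<^sub>R u = t *\<^sub>R q - p"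
  proof -
    have "((t\<^sup>2 - 1) * (p \<bullet> u)) *\<^sub>R u = - (((1 - t\<^sup>2) * (p \<bullet> u)) *\<^sub>R u)"
      by (simp add: algebra_simps)
    then show ?thesis
      by (simp flip: rel)
  qed
  have p': "r *\<^sub>R p + ((t\<^sup>2 - 1) * ((r *\<^sub>R p) \<bullet> u)) *\<^sub>R u = (t * r) *\<^sub>R q"
  proof -
    have "((t\<^sup>2 - 1) * ((r *\<^sub>R p) \<bullet> u)) *\<^sub>R u = r *\<^sub>R (((t\<^sup>2 - 1) * (p \<bullet> u)) *\<^sub>R u)"
      by simp
    also have "\<dots> = r *\<^sub>R (t *\<^sub>R q - p)"
      by (simp only: neg)
    finally show ?thesis
      by (simp add: algebra_simps)
  qed
  \<comment> \<open>The coefficient of \<open>q\<close> is r (1 + t^2), and 1 + t^2 = 4 t makes it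
    an integer multiple of \<open>t * r\<close>.\<close>
  have q': "r *\<^sub>R q + ((t\<^sup>2 - 1) * ((r *\<^sub>R q) \<bullet> u)) *\<^sub>R u = 4 *\<^sub>R ((t * r) *\<^sub>R q) - (t * r) *\<^sub>R p"
  proof -
    have "((t\<^sup>2 - 1) * ((r *\<^sub>R q) \<bullet> u)) *\<^sub>R u = (t * r) *\<^sub>R (((t\<^sup>2 - 1) * (p \<bullet> u)) *\<^sub>R u)"
      by (simp add: qu mult_ac)
    also have "\<dots> = (t * r) *\<^sub>R (t *\<^sub>R q - p)"
      by (simp only: neg)
    also have "\<dots> = (r * t\<^sup>2) *\<^sub>R q - (t * r) *\<^sub>R p"
      by (simp add: scaleR_diff_right power2_eq_square mult_ac)
    finally show ?thesis
      by (simp add: t algebra_simps)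
  qed
  \<comment> \<open>The change of basis has determinant 1; its inverse recovers x as 4 y - (4 y -
    x).\<close>
  have "lattice_at P y (4 *\<^sub>R y - x) = lattice_at P x y" for x y
  proof
    show "lattice_at P y (4 *\<^sub>R y - x) \<subseteq> lattice_at P x y"
      by (rule lattice_at_subset[where i = 0 and j = 1 and k = "-1" and l = 4]) simp_all
    show "lattice_at P x y \<subseteq> lattice_at P y (4 *\<^sub>R y - x)"
      by (rule lattice_at_subset[where i = 4 and j = "-1" and k = 1 and l = 0]) simp_all
  qed
  then show ?thesis
    by (simp only: scaling_lattice_at p' q')
qed

lemma scaling_power_homothetic:
  assumes "norm u = 1" "t\<^sup>2 = 4 * t - 1"
    and "p - t *\<^sub>R q = ((1 - t\<^sup>2) * (p \<bullet> u)) *\<^sub>R u" "q \<bullet> u = t * (p \<bullet> u)"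
  shows "scaling P u ((t\<^sup>2) ^ k) ` lattice_at P p q = lattice_at P (t ^ k *\<^sub>R p) (t ^ k *\<^sub>R q)"
proof (induction k)
  case 0
  show ?case
    by (simp add: scaling_def)
next
  case (Suc k)
  \<comment> \<open>Scalings with the same centre and direction compose by multiplying their
    factors.\<close>
  have "scaling P u ((t\<^sup>2) ^ Suc k) = scaling P u (t\<^sup>2) \<circ> scaling P u ((t\<^sup>2) ^ k)"
    by (rule ext) (simp only: power_Suc o_apply scaling_mult[OF assms(1)])
  then show ?case
    by (simp only: image_comp[symmetric] Suc.IH scaling_homothetic[OF assms] power_Suc)
qed

section \<open>A lattice basis adapted to the direction of scaling\<close>

text \<open>The two vectors at 60 degrees to \<open>e\<close> are \<open>f\<close> and
  \<open>e - f\<close>. One makes 75 degrees with the line of \<open>u\<close>, the other 45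
  degrees; the former is the required \<open>q\<close>.\<close>

lemma fifteen_degree_basis:
  assumes u: "norm u = 1" and "a > 0"
    and e: "norm e = a" and f: "norm f = a" and ef: "e \<bullet> f = a\<^sup>2 / 2"
    and t: "t\<^sup>2 = 4 * t - 1" and eu: "4 * t * (e \<bullet> u)\<^sup>2 = a\<^sup>2"
  obtains q where "norm q = a" "e \<bullet> q = a\<^sup>2 / 2" "q \<bullet> u = t * (e \<bullet> u)"
    "lattice_at P e f = lattice_at P e q"
proof -
  have sq: "e \<bullet> e = a\<^sup>2" "f \<bullet> f = a\<^sup>2" "u \<bullet> u = 1"
    using u e f by (simp_all add: dot_square_norm)
  \<comment> \<open>The Gram identity gives a quadratic equation for \<open>f \<bullet> u\<close> in
    terms of \<open>e \<bullet> u\<close>.\<close>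
  have "a\<^sup>2 * ((f \<bullet> u)\<^sup>2 - (e \<bullet> u) * (f \<bullet> u) + (e \<bullet> u)\<^sup>2 - 3 / 4 * a\<^sup>2) = 0"
    using gram_determinant_zero[of e f u] unfolding sq ef by (simp add: field_simps power2_eq_square)
  then have "(f \<bullet> u)\<^sup>2 - (e \<bullet> u) * (f \<bullet> u) + (e \<bullet> u)\<^sup>2 - 3 / 4 * a\<^sup>2 = 0"
    using \<open>a > 0\<close> by simp
  then have "(f \<bullet> u)\<^sup>2 - (e \<bullet> u) * (f \<bullet> u) + (e \<bullet> u)\<^sup>2 - 3 * t * (e \<bullet> u)\<^sup>2 = 0"
    using eu by simp
  \<comment> \<open>The roots are t and 1 - t times \<open>e \<bullet> u\<close>: their product
    matches because t (1 - t) = 1 - 3 t.\<close>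
  then have "(f \<bullet> u - t * (e \<bullet> u)) * (f \<bullet> u - (1 - t) * (e \<bullet> u)) = 0"
    using t by algebra
  then consider "f \<bullet> u = t * (e \<bullet> u)" | "(e - f) \<bullet> u = t * (e \<bullet> u)"
    by (auto simp: inner_diff_left left_diff_distrib)
  then show ?thesis
  proof cases
    case 1
    show ?thesis
      using f ef 1 refl by (rule that)
  next
    case 2
    have "(e - f) \<bullet> (e - f) = a\<^sup>2"
      by (simp add: inner_diff_left inner_diff_right inner_commute[of f e] sq ef)
    then have "norm (e - f) = a"
      using \<open>a > 0\<close> by (simp add: norm_eq_sqrt_inner)
    moreover have "e \<bullet> (e - f) = a\<^sup>2 / 2"
      by (simp add: inner_diff_right sq ef)
    moreover note 2
    moreover have "lattice_at P e f = lattice_at P e (e - f)"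
    proof
      show "lattice_at P e f \<subseteq> lattice_at P e (e - f)"
        by (rule lattice_at_subset[where i = 1 and j = 0 and k = 1 and l = "-1"]) simp_all
      show "lattice_at P e (e - f) \<subseteq> lattice_at P e f"
        by (rule lattice_at_subset[where i = 1 and j = 0 and k = 1 and l = "-1"]) simp_all
    qed
    ultimately show ?thesis
      by (rule that)
  qed
qed

theorem mainTheorem1:
  fixes L :: "(real^2) set" and a :: real and P u :: "real^2"
  assumes "a > 0"
    and "equilateral_lattice a L"
    and "P \<in> L"
    and "norm u = 1"
    and "\<exists>A B C. unit_triangle a L A B C \<and> line_angle u (B - A) = pi / 12"
  shows "(\<forall>k::nat. k \<ge> 1 \<longrightarrow>
            (\<exists>b. equilateral_lattice b (scaling P u ((7 - 4 * sqrt 3) ^ k) ` L))) \<and>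
         equilateral_lattice ((2 - sqrt 3) * a) (scaling P u (7 - 4 * sqrt 3) ` L)"
proof -
  define t where "t = 2 - sqrt (3::real)"
  have t2: "t\<^sup>2 = 7 - 4 * sqrt 3"
    by (simp add: t_def power2_diff)
  then have t: "t\<^sup>2 = 4 * t - 1"
    by (simp add: t_def)
  have "t > 0"
    by (simp add: t_def real_less_lsqrt)
  obtain Q v w where vw: "norm v = a" "norm w = a" "v \<bullet> w = a\<^sup>2 / 2" and L: "L = lattice_at Q v w"
    using assms(2) by (auto simp: equilateral_lattice_iff)
  \<comment> \<open>Rebasing at the drag centre makes the base point a fixed point of every scaling
    involved.\<close>
  have LP: "L = lattice_at P v w"
    using lattice_at_translate assms(3) L by blast
  obtain A B C where "unit_triangle a L A B C" and angle: "line_angle u (B - A) = pi / 12"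
    using assms(5) by blast
  then have AB: "A \<in> L" "B \<in> L" and nBA: "norm (B - A) = a"
    by (auto simp: unit_triangle_def dist_norm norm_minus_commute)
  \<comment> \<open>Rebasing at \<open>A\<close> exhibits the side \<open>B - A\<close> as an
    integer combination of \<open>v\<close> and \<open>w\<close>.\<close>
  have "B \<in> lattice_at A v w"
    using AB L lattice_at_translate by blast
  then obtain m n :: int where "B - A = of_int m *\<^sub>R v + of_int n *\<^sub>R w"
    by (auto simp: lattice_at_def)
  then obtain f where f: "norm f = a" "(B - A) \<bullet> f = a\<^sup>2 / 2"
    and Lf: "lattice_at P v w = lattice_at P (B - A) f"
    using unit_vector_extends_to_basis[OF vw assms(1) nBA] by metis
  have pu: "4 * t * ((B - A) \<bullet> u)\<^sup>2 = a\<^sup>2"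
    using line_angle_pi_twelfthD[OF assms(4) nBA assms(1) angle]
    by (simp add: t_def inner_commute)
  obtain q where q: "norm q = a" "(B - A) \<bullet> q = a\<^sup>2 / 2" and qu: "q \<bullet> u = t * ((B - A) \<bullet> u)"
    and Lq: "lattice_at P (B - A) f = lattice_at P (B - A) q"
    using fifteen_degree_basis[OF assms(4) assms(1) nBA f t pu] by metis
  have image: "scaling P u ((7 - 4 * sqrt 3) ^ k) ` L
      = lattice_at P (t ^ k *\<^sub>R (B - A)) (t ^ k *\<^sub>R q)" for k
    unfolding LP Lf Lq t2[symmetric]
    by (intro scaling_power_homothetic fifteen_degree_relation[OF assms(4) nBA q t pu qu] assms(4) t qu)
  \<comment> \<open>The explicit side length serves as the witness \<open>b\<close> for every k, and
    k = 1 gives the second claim.\<close>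
  have *: "equilateral_lattice (t ^ k * a) (scaling P u ((7 - 4 * sqrt 3) ^ k) ` L)" for k
    unfolding equilateral_lattice_iff image
  proof (intro conjI exI)
    show "norm (t ^ k *\<^sub>R (B - A)) = t ^ k * a" "norm (t ^ k *\<^sub>R q) = t ^ k * a"
      using nBA q(1) \<open>t > 0\<close> by simp_all
    have "(t ^ k *\<^sub>R (B - A)) \<bullet> (t ^ k *\<^sub>R q) = t ^ k * t ^ k * ((B - A) \<bullet> q)"
      by simp
    then show "(t ^ k *\<^sub>R (B - A)) \<bullet> (t ^ k *\<^sub>R q) = (t ^ k * a)\<^sup>2 / 2"
      by (simp only: q(2)) (simp add: power2_eq_square)
  qed (use \<open>t > 0\<close> \<open>a > 0\<close> in auto)
  show ?thesis
    using * *[of 1] by (auto simp: t_def)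
qed

end
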